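(* Suppose that $n\ge 3$. If $\Psi:\mathrm{Conv}(\mathbb{C}^n,\mathbb{R})\to\mathrm{Conv}(\mathbb{C}^n,\mathbb{R})$ is a continuous, dually epi-translation-invariant and $\mathrm{SL}(n,\mathbb{C})$-contravariant valuation, then there exists $c\in\mathbb{R}$ such that $\Psi(f)\equiv c$ for every $f\in\mathrm{Conv}(\mathbb{C}^n,\mathbb{R})$.
   Context: $\mathrm{Conv}(\mathbb{C}^n,\mathbb{R})$ is the space of all finite convex functions $f:\mathbb{C}^n\cong\mathbb{R}^{2n}\to\mathbb{R}$, with the topology induced by epi-convergence (on this space it coincides with the topology of pointwise convergence and with that of locally uniform convergence); continuity of $\Psi$ is with respect to this topology. $\Psi$ is a valuation if $\Psi(\max\{f,h\})+\Psi(\min\{f,h\})=\Psi(f)+\Psi(h)$ (pointwise maximum, minimum and addition) whenever $f,h,\min\{f,h\}\in\mathrm{Conv}(\mathbb{C}^n,\mathbb{R})$. $\Psi$ is dually epi-translation-invariant if $\Psi(f+\ell)=\Psi(f)$ for all $f\in\mathrm{Conv}(\mathbb{C}^n,\mathbb{R})$ and all real affine maps $\ell:\mathbb{C}^n\to\mathbb{R}$. $\Psi$ is $\mathrm{SL}(n,\mathbb{C})$-contravariant if $\Psi(f\circ g)=\Psi(f)\circ g^{-*}$ for all $f\in\mathrm{Conv}(\mathbb{C}^n,\mathbb{R})$ and $g\in\mathrm{SL}(n,\mathbb{C})$, where $g^{-*}$ denotes the conjugate transpose of $g^{-1}$. *)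

theory Defs
  imports "HOL-Analysis.Analysis"
begin

definition Conv :: "(complex ^ 'n \<Rightarrow> real) set" where
  "Conv = {f. convex_on UNIV f}"

definition epi_converges ::
    "(nat \<Rightarrow> complex ^ 'n \<Rightarrow> real) \<Rightarrow> (complex ^ 'n \<Rightarrow> real) \<Rightarrow> bool" where
  "epi_converges F f \<longleftrightarrow>
     (\<forall>x. (\<forall>y. y \<longlonglongrightarrow> x \<longrightarrow> ereal (f x) \<le> liminf (\<lambda>k. ereal (F k (y k)))) \<and>
          (\<exists>y. y \<longlonglongrightarrow> x \<and> (\<lambda>k. F k (y k)) \<longlonglongrightarrow> f x))"

(* The topology induced by epi-convergence, given by its open sets: U is open iff every sequence
   of finite convex functions epi-converging to a member of U is eventually in U; equivalently,
   the closed sets are the sequentially epi-closed ones.  On Conv, epi-convergence is locally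
   uniform convergence, which is metrizable, so no open sets are lost or gained by using
   sequences. *)
definition epi_topology :: "(complex ^ 'n \<Rightarrow> real) topology" where
  "epi_topology = topology (\<lambda>U. U \<subseteq> Conv \<and>
     (\<forall>F f. range F \<subseteq> Conv \<and> f \<in> U \<and> epi_converges F f \<longrightarrow> eventually (\<lambda>k. F k \<in> U) sequentially))"

lemma openin_epi_topology:
  fixes U :: "(complex ^ 'n \<Rightarrow> real) set"
  shows "openin epi_topology U \<longleftrightarrow> U \<subseteq> Conv \<and>
     (\<forall>F f. range F \<subseteq> Conv \<and> f \<in> U \<and> epi_converges F f \<longrightarrow> eventually (\<lambda>k. F k \<in> U) sequentially)"
proof -
  have "istopology (\<lambda>U. U \<subseteq> Conv \<and>
     (\<forall>F (f :: complex ^ 'n \<Rightarrow> real). range F \<subseteq> Conv \<and> f \<in> U \<and> epi_converges F f \<longrightarrow>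
        eventually (\<lambda>k. F k \<in> U) sequentially))"
    unfolding istopology_def
  proof (intro conjI allI impI)
    fix S T :: "(complex ^ 'n \<Rightarrow> real) set" and F f
    assume "S \<subseteq> Conv \<and> (\<forall>F f. range F \<subseteq> Conv \<and> f \<in> S \<and> epi_converges F f \<longrightarrow>
              eventually (\<lambda>k. F k \<in> S) sequentially)"
      and "T \<subseteq> Conv \<and> (\<forall>F f. range F \<subseteq> Conv \<and> f \<in> T \<and> epi_converges F f \<longrightarrow>
              eventually (\<lambda>k. F k \<in> T) sequentially)"
      and "range F \<subseteq> Conv \<and> f \<in> S \<inter> T \<and> epi_converges F f"
    then have "eventually (\<lambda>k. F k \<in> S) sequentially" "eventually (\<lambda>k. F k \<in> T) sequentially"
      by blast+
    then show "eventually (\<lambda>k. F k \<in> S \<inter> T) sequentially"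
      by eventually_elim simp
  next
    fix \<K> :: "(complex ^ 'n \<Rightarrow> real) set set" and F f
    assume K: "\<forall>K\<in>\<K>. K \<subseteq> Conv \<and> (\<forall>F f. range F \<subseteq> Conv \<and> f \<in> K \<and> epi_converges F f \<longrightarrow>
              eventually (\<lambda>k. F k \<in> K) sequentially)"
      and f: "range F \<subseteq> Conv \<and> f \<in> \<Union> \<K> \<and> epi_converges F f"
    then obtain K where "K \<in> \<K>" "f \<in> K" by blast
    with K f have "eventually (\<lambda>k. F k \<in> K) sequentially" by blast
    then show "eventually (\<lambda>k. F k \<in> \<Union> \<K>) sequentially"
      by (rule eventually_mono) (use \<open>K \<in> \<K>\<close> in blast)
  qed blast+
  then show ?thesis
    unfolding epi_topology_def by (simp only: topology_inverse')
qed

lemma topspace_epi_topology [simp]: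
  "topspace epi_topology = (Conv :: (complex ^ 'n \<Rightarrow> real) set)"
proof
  show "topspace epi_topology \<subseteq> (Conv :: (complex ^ 'n \<Rightarrow> real) set)"
    using openin_epi_topology openin_topspace by blast
  have "openin epi_topology (Conv :: (complex ^ 'n \<Rightarrow> real) set)"
    unfolding openin_epi_topology by (auto intro!: always_eventually)
  then show "Conv \<subseteq> topspace (epi_topology :: (complex ^ 'n \<Rightarrow> real) topology)"
    by (rule openin_subset)
qed

definition valuation_on_Conv ::
    "((complex ^ 'n \<Rightarrow> real) \<Rightarrow> (complex ^ 'n \<Rightarrow> real)) \<Rightarrow> bool" where
  "valuation_on_Conv \<Psi> \<longleftrightarrow>
     (\<forall>f h. f \<in> Conv \<and> h \<in> Conv \<and> (\<lambda>x. min (f x) (h x)) \<in> Conv \<longrightarrow>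
        (\<forall>z. \<Psi> (\<lambda>x. max (f x) (h x)) z + \<Psi> (\<lambda>x. min (f x) (h x)) z = \<Psi> f z + \<Psi> h z))"

definition dually_epi_translation_invariant ::
    "((complex ^ 'n \<Rightarrow> real) \<Rightarrow> (complex ^ 'n \<Rightarrow> real)) \<Rightarrow> bool" where
  "dually_epi_translation_invariant \<Psi> \<longleftrightarrow>
     (\<forall>f \<in> Conv. \<forall>u c. linear u \<longrightarrow> \<Psi> (\<lambda>x. f x + (u x + c)) = \<Psi> f)"

definition SL :: "(complex ^ 'n ^ 'n) set" where
  "SL = {g. det g = 1}"

definition conj_transpose :: "complex ^ 'n ^ 'm \<Rightarrow> complex ^ 'm ^ 'n" where
  "conj_transpose A = (\<chi> i j. cnj (A $ j $ i))"

definition SL_contravariant ::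
    "((complex ^ 'n \<Rightarrow> real) \<Rightarrow> (complex ^ 'n \<Rightarrow> real)) \<Rightarrow> bool" where
  "SL_contravariant \<Psi> \<longleftrightarrow>
     (\<forall>f \<in> Conv. \<forall>g \<in> SL.
        \<Psi> (f \<circ> (\<lambda>x. g *v x)) = \<Psi> f \<circ> (\<lambda>x. conj_transpose (matrix_inv g) *v x))"

end

theory Submission imports Defs begin

text \<open>
  Fix a point \<open>z\<close> and consider the real-valued valuation \<open>\<mu> f = \<Psi> f z\<close>. It is invariant under
  composition with every \<open>g \<in> SL\<close> whose conjugate transpose fixes \<open>z\<close>. This stabilizer is so large
  that every point other than the origin can be moved off to infinity by it, and this forces
  \<open>\<mu>\<close> to be blind to everything that a convex function does away from the origin.

  The mechanism is as follows. Suppose that \<open>h \<le> f\<close> differ only on a bounded set \<open>B\<close>, and that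
  stabilizing maps \<open>g\<close> exist whose preimages of \<open>B\<close> leave every ball through a fixed direction.
  Infinitely many transformed copies of the pair \<open>(h, f)\<close>, each tilted by a suitable affine
  function, can then be glued far apart into one pair \<open>P \<le> Q\<close> of finite convex functions.
  By the valuation property, gluing in one further copy changes \<open>\<mu> Q - \<mu> P\<close> by exactly
  \<open>\<mu> f - \<mu> h\<close>, while by continuity the partial differences converge. Hence
  \<open>\<mu> f = \<mu> h\<close> (\<open>eq_if_difference_escapes\<close>).

  The stabilizing maps are transvections \<open>x \<mapsto> x + herm a x *s c\<close> with \<open>herm a c = 0\<close> and
  \<open>herm z c = 0\<close>. They move every bounded part of a half-space \<open>{x. d \<le> a \<bullet> x}\<close>, \<open>d > 0\<close>, off to
  infinity along \<open>c\<close>. A vector \<open>c \<noteq> 0\<close> orthogonal to both \<open>a\<close> and \<open>z\<close> exists for every \<open>a\<close> because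
  the dimension is at least 3; in dimension 2 it need not, and indeed the stabilizer of \<open>z \<noteq> 0\<close>
  then fixes all points of the complex line orthogonal to \<open>z\<close>.

  Consequently, taking the maximum of a nonnegative convex function and an affine function that is
  negative at the origin does not change \<open>\<mu>\<close>, as long as this modifies the function on a bounded set only
  (\<open>max_affine_eq_if_bounded\<close>). Cutting off with a steep cone at infinity removes the boundedness
  condition, so \<open>\<mu>\<close> takes the value \<open>\<mu> 0\<close> on all maxima of \<open>0\<close> with finitely many affine
  functions that are negative at the origin. Up to an affine function every convex function is a
  limit of such maxima, and so \<open>\<mu> f = \<mu> 0\<close>. It remains to see that \<open>\<Psi> 0\<close> is a constant function,
  which holds because it is continuous and invariant under all transvections.
\<close>

section \<open>Convex functions and epi-convergence\<close>

lemma Conv_max: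
  assumes f: "f \<in> Conv" and h: "h \<in> Conv"
  shows "(\<lambda>x. max (f x) (h x)) \<in> Conv"
  unfolding Conv_def convex_on_def mem_Collect_eq
proof (intro conjI convex_UNIV ballI allI impI)
  fix x y and u v :: real
  assume uv: "0 \<le> u" "0 \<le> v" "u + v = 1"
  have "f (u *\<^sub>R x + v *\<^sub>R y) \<le> u * f x + v * f y" "h (u *\<^sub>R x + v *\<^sub>R y) \<le> u * h x + v * h y"
    using f h uv by (auto simp: Conv_def convex_on_def)
  moreover have "u * f x + v * f y \<le> u * max (f x) (h x) + v * max (f y) (h y)"
    "u * h x + v * h y \<le> u * max (f x) (h x) + v * max (f y) (h y)"
    using uv by (auto intro!: add_mono mult_left_mono)
  ultimately show "max (f (u *\<^sub>R x + v *\<^sub>R y)) (h (u *\<^sub>R x + v *\<^sub>R y))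
      \<le> u * max (f x) (h x) + v * max (f y) (h y)" by linarith
qed

lemma Conv_affine:
  fixes a :: "complex ^ 'a"
  shows "(\<lambda>x. a \<bullet> x + c) \<in> Conv"
  unfolding Conv_def convex_on_def
proof (intro CollectI conjI convex_UNIV ballI allI impI)
  fix x y :: "complex ^ 'a" and u v :: real assume "u + v = 1"
  then have "c = u * c + v * c" by (simp flip: distrib_right)
  then show "a \<bullet> (u *\<^sub>R x + v *\<^sub>R y) + c \<le> u * (a \<bullet> x + c) + v * (a \<bullet> y + c)"
    by (simp add: inner_add_right algebra_simps)
qed

lemma Conv_const: "(\<lambda>x. c) \<in> Conv"
  using Conv_affine[of 0 c] by simp

lemma Conv_add_affine: "f \<in> Conv \<Longrightarrow> (\<lambda>x. f x + (a \<bullet> x + c)) \<in> Conv"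
  using Conv_affine[of a c] unfolding Conv_def by (auto intro: convex_on_add)

lemma Conv_comp_linear: "f \<in> Conv \<Longrightarrow> linear g \<Longrightarrow> f \<circ> g \<in> Conv"
  unfolding Conv_def convex_on_def by (auto simp: linear_add linear_scale)

lemma Conv_continuous: "f \<in> Conv \<Longrightarrow> continuous_on A f"
  unfolding Conv_def using convex_on_continuous[of UNIV f] continuous_on_subset by auto

lemma Conv_tendsto: "f \<in> Conv \<Longrightarrow> (y \<longlongrightarrow> x) F \<Longrightarrow> ((\<lambda>k. f (y k)) \<longlongrightarrow> f x) F"
  using Conv_continuous[of f UNIV] by (auto simp: continuous_on_def intro: tendsto_compose)

lemma Conv_pointwise_limit:
  assumes "\<And>k::nat. F k \<in> Conv" "\<And>x. (\<lambda>k. F k x) \<longlonglongrightarrow> f x"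
  shows "f \<in> Conv"
  unfolding Conv_def convex_on_def mem_Collect_eq
proof (intro conjI convex_UNIV ballI allI impI)
  fix x y and u v :: real assume uv: "0 \<le> u" "0 \<le> v" "u + v = 1"
  show "f (u *\<^sub>R x + v *\<^sub>R y) \<le> u * f x + v * f y"
  proof (rule LIMSEQ_le)
    show "(\<lambda>k. F k (u *\<^sub>R x + v *\<^sub>R y)) \<longlonglongrightarrow> f (u *\<^sub>R x + v *\<^sub>R y)"
      "(\<lambda>k. u * F k x + v * F k y) \<longlonglongrightarrow> u * f x + v * f y"
      by (intro tendsto_intros assms(2))+
    show "\<exists>N. \<forall>n\<ge>N. F n (u *\<^sub>R x + v *\<^sub>R y) \<le> u * F n x + v * F n y"
      using assms(1) uv unfolding Conv_def convex_on_def by auto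
  qed
qed

lemma Conv_bounded_on:
  assumes "f \<in> Conv" "bounded B"
  obtains C where "\<And>x. x \<in> B \<Longrightarrow> \<bar>f x\<bar> \<le> C"
proof -
  have "compact (f ` closure B)"
    using assms by (intro compact_continuous_image Conv_continuous) auto
  then have "bounded (f ` closure B)" by (rule compact_imp_bounded)
  then obtain C where "\<forall>y\<in>f ` closure B. norm y \<le> C" by (auto simp: bounded_iff)
  then show thesis using closure_subset[of B] by (intro that[of C]) auto
qed

lemma Conv_scaled_norm: "0 \<le> L \<Longrightarrow> (\<lambda>x. L * norm x - M) \<in> Conv"
proof -
  assume L: "0 \<le> L"
  have "convex_on UNIV (\<lambda>x::complex^'n. dist 0 x)" by (rule convex_on_dist[OF convex_UNIV])
  then have "convex_on UNIV (\<lambda>x::complex^'n. L * norm x)"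
    using convex_on_cmul[OF L] by simp
  from convex_on_add[OF this, of "\<lambda>x. - M"] show ?thesis
    unfolding Conv_def by (simp add: convex_on_const)
qed

lemma epi_converges_if_locally_uniform:
  fixes F :: "nat \<Rightarrow> complex ^ 'n \<Rightarrow> real"
  assumes f: "f \<in> Conv"
    and unif: "\<And>R e. 0 < e \<Longrightarrow> \<forall>\<^sub>F k in sequentially. \<forall>x\<in>cball 0 R. \<bar>F k x - f x\<bar> \<le> e"
  shows "epi_converges F f"
proof -
  have lim: "(\<lambda>k. F k (y k)) \<longlonglongrightarrow> f x" if y: "y \<longlonglongrightarrow> x" for x :: "complex ^ 'n" and y :: "nat \<Rightarrow> complex ^ 'n"
  proof -
    have "bounded (range y)" using y by (rule convergent_imp_bounded)
    then obtain R where "\<forall>x\<in>range y. norm x \<le> R" unfolding bounded_iff by blast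
    then have R: "y k \<in> cball 0 R" for k by simp
    have "(\<lambda>k. F k (y k) - f (y k)) \<longlonglongrightarrow> 0"
    proof (rule tendstoI)
      fix e :: real assume e: "0 < e"
      then have "\<forall>\<^sub>F k in sequentially. \<forall>x\<in>cball 0 R. \<bar>F k x - f x\<bar> \<le> e / 2"
        by (intro unif) simp
      then show "\<forall>\<^sub>F k in sequentially. dist (F k (y k) - f (y k)) 0 < e"
      proof (rule eventually_mono)
        fix k assume "\<forall>x\<in>cball 0 R. \<bar>F k x - f x\<bar> \<le> e / 2"
        then have "\<bar>F k (y k) - f (y k)\<bar> \<le> e / 2" using R by blast
        then show "dist (F k (y k) - f (y k)) 0 < e" using e by (simp add: dist_real_def)
      qed
    qed
    from tendsto_add[OF this Conv_tendsto[OF f y]] show ?thesis by simp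
  qed
  show ?thesis unfolding epi_converges_def
  proof (intro allI conjI impI)
    fix x :: "complex ^ 'n" and y :: "nat \<Rightarrow> complex ^ 'n" assume "y \<longlonglongrightarrow> x"
    then have "(\<lambda>k. ereal (F k (y k))) \<longlonglongrightarrow> ereal (f x)"
      by (intro tendsto_intros lim)
    then have "liminf (\<lambda>k. ereal (F k (y k))) = ereal (f x)"
      by (rule lim_imp_Liminf[OF sequentially_bot])
    then show "ereal (f x) \<le> liminf (\<lambda>k. ereal (F k (y k)))" by (rule eq_refl[OF sym])
  next
    fix x :: "complex ^ 'n"
    show "\<exists>y. y \<longlonglongrightarrow> x \<and> (\<lambda>k. F k (y k)) \<longlonglongrightarrow> f x"
      by (rule exI[of _ "\<lambda>_. x"], intro conjI lim tendsto_const)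
  qed
qed

text \<open>
  The sublevel set \<open>{x. f x < f z}\<close> is convex and misses \<open>z\<close>, so a hyperplane through \<open>z\<close> supports it.
\<close>
lemma Conv_halfspace_above_value:
  fixes f :: "complex ^ 'n \<Rightarrow> real"
  assumes "f \<in> Conv"
  obtains u where "norm u = 1" "\<And>x. 0 < u \<bullet> (x - z) \<Longrightarrow> f z \<le> f x"
proof -
  define S where "S = (\<lambda>x. x - z) ` {x. f x < f z}"
  have "convex {x. f x < f z}"
    unfolding convex_def
  proof (intro ballI allI impI CollectI)
    fix x y and s t :: real assume *: "x \<in> {x. f x < f z}" "y \<in> {x. f x < f z}" "0 \<le> s" "0 \<le> t" "s + t = 1"
    then have "f (s *\<^sub>R x + t *\<^sub>R y) \<le> max (f x) (f y)"
      using assms by (intro convex_lower) (auto simp: Conv_def)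
    then show "f (s *\<^sub>R x + t *\<^sub>R y) < f z" using * by simp
  qed
  then have "convex S" unfolding S_def by (simp add: convex_translation_subtract)
  moreover have "0 \<notin> S" by (auto simp: S_def)
  ultimately obtain a where a: "a \<noteq> 0" "\<And>y. y \<in> S \<Longrightarrow> 0 \<le> a \<bullet> y"
    using separating_hyperplane_set_0[of S] by auto
  show thesis
  proof (rule that[of "- (a /\<^sub>R norm a)"])
    show "norm (- (a /\<^sub>R norm a)) = 1" using a by simp
    fix x assume "0 < - (a /\<^sub>R norm a) \<bullet> (x - z)"
    then have "0 < - (a \<bullet> (x - z))" using a(1) by (auto simp: zero_less_mult_iff mult_less_0_iff)
    then show "f z \<le> f x" using a(2)[of "x - z"] by (force simp: S_def)
  qed
qed

text \<open>
  The lower bound is part of the definition. If the upper bound fails at \<open>z\<close>, then infinitely many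
  \<open>F k\<close> are at least \<open>c > f z\<close> on a whole open half-space with \<open>z\<close> on its boundary. By compactness
  the unit normals of these half-spaces accumulate at some \<open>v\<close>; recovery sequences for the points
  \<open>z + t *\<^sub>R v\<close> then give \<open>c \<le> f (z + t *\<^sub>R v)\<close> for all \<open>t > 0\<close>, against the continuity of \<open>f\<close>.
\<close>
lemma epi_converges_imp_pointwise:
  fixes F :: "nat \<Rightarrow> complex ^ 'n \<Rightarrow> real"
  assumes F: "\<And>k. F k \<in> Conv" and f: "f \<in> Conv" and epi: "epi_converges F f"
  shows "(\<lambda>k. F k z) \<longlonglongrightarrow> f z"
proof (rule order_tendstoI)
  fix c assume "c < f z"
  also have "ereal (f z) \<le> liminf (\<lambda>k. ereal (F k z))"
    using epi unfolding epi_converges_def by (auto dest!: spec[of _ z] spec[of _ "\<lambda>_. z"])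
  finally (less_le_trans[of "ereal c" "ereal _", simplified])
  have "ereal c < liminf (\<lambda>k. ereal (F k z))" .
  then show "\<forall>\<^sub>F k in sequentially. c < F k z"
    by (auto dest: less_LiminfD)
next
  fix c assume c: "f z < c"
  show "\<forall>\<^sub>F k in sequentially. F k z < c"
  proof (rule ccontr)
    assume "\<not> ?thesis"
    then have "\<exists>\<^sub>F k in sequentially. c \<le> F k z" by (simp add: frequently_def not_le)
    then have inf: "infinite {k. c \<le> F k z}"
      by (simp add: frequently_cofinite flip: cofinite_eq_sequentially)
    define r where "r = enumerate {k. c \<le> F k z}"
    have r: "strict_mono r" "\<And>k. c \<le> F (r k) z"
      using inf strict_mono_enumerate[OF inf] enumerate_in_set[OF inf] by (auto simp: r_def)
    have "\<forall>k. \<exists>u. norm u = 1 \<and> (\<forall>x. 0 < u \<bullet> (x - z) \<longrightarrow> F k z \<le> F k x)"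
      using Conv_halfspace_above_value[OF F] by metis
    then obtain u where u: "\<And>k. norm (u k) = 1"
      "\<And>k x. 0 < u k \<bullet> (x - z) \<Longrightarrow> F k z \<le> F k x" by metis
    have "\<And>k. (u \<circ> r) k \<in> sphere 0 1" using u by simp
    then obtain v s where v: "v \<in> sphere 0 1" and s: "strict_mono s" "(u \<circ> r \<circ> s) \<longlonglongrightarrow> v"
      using compact_sphere[of "0::complex^'n" 1] unfolding compact_def by metis
    have far: "c \<le> f (z + t *\<^sub>R v)" if t: "0 < t" for t
    proof -
      obtain y where y: "y \<longlonglongrightarrow> z + t *\<^sub>R v" "(\<lambda>k. F k (y k)) \<longlonglongrightarrow> f (z + t *\<^sub>R v)"
        using epi unfolding epi_converges_def by blast
      define q where "q = r \<circ> s"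
      have q: "strict_mono q" using r s by (simp add: q_def strict_mono_o)
      have yq: "(\<lambda>k. y (q k)) \<longlonglongrightarrow> z + t *\<^sub>R v" "(\<lambda>k. F (q k) (y (q k))) \<longlonglongrightarrow> f (z + t *\<^sub>R v)"
        using LIMSEQ_subseq_LIMSEQ[OF y(1) q] LIMSEQ_subseq_LIMSEQ[OF y(2) q] by (auto simp: o_def)
      have uq: "(\<lambda>k. u (q k)) \<longlonglongrightarrow> v" using s(2) by (simp add: q_def o_def)
      have "(\<lambda>k. u (q k) \<bullet> (y (q k) - z)) \<longlonglongrightarrow> v \<bullet> ((z + t *\<^sub>R v) - z)"
        by (intro tendsto_intros uq yq)
      moreover have "v \<bullet> ((z + t *\<^sub>R v) - z) > 0" using v t by (simp add: dot_square_norm)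
      ultimately have "\<forall>\<^sub>F k in sequentially. 0 < u (q k) \<bullet> (y (q k) - z)"
        by (rule order_tendstoD)
      then have "\<forall>\<^sub>F k in sequentially. c \<le> F (q k) (y (q k))"
      proof (rule eventually_mono)
        fix k assume "0 < u (q k) \<bullet> (y (q k) - z)"
        then have "F (q k) z \<le> F (q k) (y (q k))" by (rule u(2))
        moreover have "c \<le> F (q k) z" using r(2) by (simp add: q_def)
        ultimately show "c \<le> F (q k) (y (q k))" by linarith
      qed
      then show ?thesis by (rule tendsto_lowerbound[OF yq(2)]) simp
    qed
    have "(\<lambda>k. z + inverse (real (Suc k)) *\<^sub>R v) \<longlonglongrightarrow> z + 0 *\<^sub>R v"
      by (intro tendsto_intros LIMSEQ_inverse_real_of_nat)
    then have "(\<lambda>k. f (z + inverse (real (Suc k)) *\<^sub>R v)) \<longlonglongrightarrow> f z"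
      using Conv_tendsto[OF f] by fastforce
    then have "c \<le> f z"
      by (rule tendsto_lowerbound) (auto intro!: always_eventually far)
    then show False using c by simp
  qed
qed

text \<open>
  The slack \<open>e\<close> puts \<open>(x0, f x0 - e)\<close> strictly outside the closed epigraph, so that the separating
  hyperplane is not vertical.
\<close>
lemma Conv_affine_minorant:
  assumes f: "f \<in> Conv" and "0 < e"
  obtains a c where "\<And>x. a \<bullet> x + c \<le> f x" "f x0 - e < a \<bullet> x0 + c"
proof -
  have "convex (epigraph UNIV f)" using f by (simp add: Conv_def convex_epigraph)
  moreover have "closed (epigraph UNIV f)"
  proof -
    have "continuous_on UNIV (\<lambda>xy. f (fst xy))"
      by (intro continuous_on_compose2[OF Conv_continuous[OF f]] continuous_intros) auto
    then have "closed {xy. f (fst xy) \<le> snd xy}"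
      by (intro closed_Collect_le continuous_intros)
    then show ?thesis by (simp add: epigraph_def)
  qed
  moreover have "(x0, f x0 - e) \<notin> epigraph UNIV f" using \<open>0 < e\<close> by (simp add: epigraph_def)
  ultimately obtain p b where "p \<bullet> (x0, f x0 - e) < b" "\<forall>w\<in>epigraph UNIV f. b < p \<bullet> w"
    using separating_hyperplane_closed_point[of "epigraph UNIV f" "(x0, f x0 - e)"] by auto
  then obtain p1 q where pq: "p1 \<bullet> x0 + q * (f x0 - e) < b" "\<And>x. b < p1 \<bullet> x + q * f x"
    by (cases p) (auto simp: epigraph_def)
  have "q * (f x0 - e) < q * f x0" using pq(1) pq(2)[of x0] by linarith
  then have "0 < q" using \<open>0 < e\<close> by (simp add: mult_less_cancel_left)
  show thesis
  proof (rule that[of "- (p1 /\<^sub>R q)" "b / q"])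
    show "- (p1 /\<^sub>R q) \<bullet> x + b / q \<le> f x" for x
      using pq(2)[of x] \<open>0 < q\<close> by (simp add: field_simps)
    show "f x0 - e < - (p1 /\<^sub>R q) \<bullet> x0 + b / q"
      using pq(1) \<open>0 < q\<close> by (simp add: field_simps)
  qed
qed

lemma Conv_stationary_limit:
  fixes F :: "nat \<Rightarrow> complex ^ 'm \<Rightarrow> real"
  assumes F: "\<And>k. F k \<in> Conv"
    and stat: "\<And>k x. x \<in> cball 0 (real k) \<Longrightarrow> F (Suc k) x = F k x"
  obtains f where "f \<in> Conv" "epi_converges F f"
proof -
  have stat': "F j x = F k x" if "x \<in> cball 0 (real k)" "k \<le> j" for x :: "complex ^ 'm" and j k :: nat
    using that(2) that(1)
  proof (induction j rule: dec_induct)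
    case (step m)
    then have "x \<in> cball 0 (real m)" by auto
    with step show ?case using stat[of x m] by simp
  qed simp
  define f where "f = (\<lambda>x. F (nat \<lceil>norm x\<rceil>) x)"
  have f_eq: "F j x = f x" if "x \<in> cball 0 (real k)" "k \<le> j" for x :: "complex ^ 'm" and j k :: nat
  proof -
    have "nat \<lceil>norm x\<rceil> \<le> k" using that(1) by (simp add: ceiling_le_iff)
    then show ?thesis unfolding f_def using that(2) by (intro stat') auto
  qed
  have "f \<in> Conv"
  proof (rule Conv_pointwise_limit[OF F])
    fix x :: "complex ^ 'm"
    have "\<forall>\<^sub>F j in sequentially. F j x = f x"
      using f_eq[of x "nat \<lceil>norm x\<rceil>"] by (intro eventually_sequentiallyI[of "nat \<lceil>norm x\<rceil>"]) auto
    then show "(\<lambda>j. F j x) \<longlonglongrightarrow> f x" by (rule tendsto_eventually)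
  qed
  moreover have "epi_converges F f"
  proof (rule epi_converges_if_locally_uniform[OF \<open>f \<in> Conv\<close>])
    fix R e :: real assume "0 < e"
    show "\<forall>\<^sub>F k in sequentially. \<forall>x\<in>cball 0 R. \<bar>F k x - f x\<bar> \<le> e"
    proof (rule eventually_sequentiallyI[of "nat \<lceil>R\<rceil>"], rule ballI)
      fix k and x :: "complex ^ 'm" assume "nat \<lceil>R\<rceil> \<le> k" "x \<in> cball 0 R"
      then have "F k x = f x" using f_eq[of x "nat \<lceil>R\<rceil>" k] real_nat_ceiling_ge[of R] by simp
      then show "\<bar>F k x - f x\<bar> \<le> e" using \<open>0 < e\<close> by simp
    qed
  qed
  ultimately show thesis by (rule that)
qed

section \<open>Invariance of a valuation under local modifications\<close>

locale affinely_invariant_valuation =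
  fixes \<mu> :: "(complex ^ 'n \<Rightarrow> real) \<Rightarrow> real"
  assumes continuous: "\<And>F f. (\<And>k. F k \<in> Conv) \<Longrightarrow> f \<in> Conv \<Longrightarrow> epi_converges F f \<Longrightarrow>
      (\<lambda>k. \<mu> (F k)) \<longlonglongrightarrow> \<mu> f"
    and affine_invariant: "\<And>f a c. f \<in> Conv \<Longrightarrow> \<mu> (\<lambda>x. f x + (a \<bullet> x + c)) = \<mu> f"
    and valuation: "\<And>f h. f \<in> Conv \<Longrightarrow> h \<in> Conv \<Longrightarrow> (\<lambda>x. min (f x) (h x)) \<in> Conv \<Longrightarrow>
      \<mu> (\<lambda>x. max (f x) (h x)) + \<mu> (\<lambda>x. min (f x) (h x)) = \<mu> f + \<mu> h"
begin

text \<open>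
  The gluing identity. The pairs \<open>P \<le> Q\<close> and \<open>h \<le> f\<close> differ in disjoint regions; in the first region
  the new pair is dominated, in the second it dominates. The first
  valuation identity below splits the total increment into one for each region; the other two
  identify these with \<open>\<mu> Q - \<mu> P\<close> and \<open>\<mu> f - \<mu> h\<close>.
\<close>
lemma increment_additive:
  assumes Conv: "P \<in> Conv" "Q \<in> Conv" "h \<in> Conv" "f \<in> Conv"
    and le: "\<And>x. P x \<le> Q x" "\<And>x. h x \<le> f x"
    and outer: "\<And>x. P x \<noteq> Q x \<Longrightarrow> f x \<le> P x"
    and inner: "\<And>x. h x \<noteq> f x \<Longrightarrow> Q x \<le> h x"
  shows "\<mu> (\<lambda>x. max (Q x) (f x)) - \<mu> (\<lambda>x. max (P x) (h x)) = (\<mu> Q - \<mu> P) + (\<mu> f - \<mu> h)"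
proof -
  let ?P = "\<lambda>x. max (P x) (h x)"
  have val: "\<mu> A + \<mu> B = \<mu> C + \<mu> D"
    if "C \<in> Conv" "D \<in> Conv" "B \<in> Conv" "\<And>x. max (C x) (D x) = A x" "\<And>x. min (C x) (D x) = B x"
    for A B C D
  proof -
    have "A = (\<lambda>x. max (C x) (D x))" "B = (\<lambda>x. min (C x) (D x))" using that by auto
    then show ?thesis using valuation[OF that(1,2)] that(3) by simp
  qed
  have 1: "\<mu> (\<lambda>x. max (Q x) (f x)) + \<mu> ?P = \<mu> (\<lambda>x. max (Q x) (h x)) + \<mu> (\<lambda>x. max (P x) (f x))"
  proof (rule val)
    fix x
    show "max (max (Q x) (h x)) (max (P x) (f x)) = max (Q x) (f x)"
      using le[of x] by linarith
    show "min (max (Q x) (h x)) (max (P x) (f x)) = max (P x) (h x)"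
      using le[of x] outer[of x] inner[of x] by (cases "P x = Q x"; cases "h x = f x") auto
  qed (intro Conv_max Conv)+
  have 2: "\<mu> (\<lambda>x. max (Q x) (h x)) + \<mu> P = \<mu> Q + \<mu> ?P"
  proof (rule val)
    fix x
    show "max (Q x) (max (P x) (h x)) = max (Q x) (h x)" using le[of x] by linarith
    show "min (Q x) (max (P x) (h x)) = P x"
      using le[of x] outer[of x] by (cases "P x = Q x") auto
  qed (intro Conv_max Conv)+
  have 3: "\<mu> (\<lambda>x. max (P x) (f x)) + \<mu> h = \<mu> f + \<mu> ?P"
  proof (rule val)
    fix x
    show "max (f x) (max (P x) (h x)) = max (P x) (f x)" using le[of x] by linarith
    show "min (f x) (max (P x) (h x)) = h x"
      using le[of x] inner[of x] by (cases "h x = f x") auto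
  qed (intro Conv_max Conv)+
  from 1 2 3 show ?thesis by linarith
qed

text \<open>
  One gluing step. The copy \<open>(h \<circ> g, f \<circ> g)\<close> receives a steep affine tilt \<open>w\<close>, which pushes it below
  \<open>P\<close> on a large ball and above \<open>Q\<close> on the region where \<open>h \<circ> g\<close> and \<open>f \<circ> g\<close> differ. Since the step
  changes nothing on the ball, infinitely many steps have a finite limit.
\<close>
lemma add_escaped_copy:
  fixes r :: real
  assumes h: "h \<in> Conv" and f: "f \<in> Conv" and le: "\<And>x. h x \<le> f x"
    and escape: "\<And>K. \<exists>g. linear g \<and> (\<forall>\<phi>\<in>Conv. \<mu> (\<phi> \<circ> g) = \<mu> \<phi>) \<and>
      bounded {x. h (g x) \<noteq> f (g x)} \<and> (\<forall>x. h (g x) \<noteq> f (g x) \<longrightarrow> K \<le> u \<bullet> x)"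
    and P: "P \<in> Conv" and Q: "Q \<in> Conv" and PQ: "\<And>x. P x \<le> Q x" "bounded {x. P x \<noteq> Q x}"
  obtains P' Q' where "P' \<in> Conv" "Q' \<in> Conv" "\<And>x. P' x \<le> Q' x" "bounded {x. P' x \<noteq> Q' x}"
    "\<And>x. x \<in> cball 0 r \<Longrightarrow> P' x = P x \<and> Q' x = Q x"
    "\<mu> Q' - \<mu> P' = (\<mu> Q - \<mu> P) + (\<mu> f - \<mu> h)"
proof -
  obtain r0 where r0: "\<And>x. P x \<noteq> Q x \<Longrightarrow> norm x \<le> r0" using PQ(2) by (auto simp: bounded_iff)
  define R where "R = max r r0"
  obtain g where g: "linear g" "\<And>\<phi>. \<phi> \<in> Conv \<Longrightarrow> \<mu> (\<phi> \<circ> g) = \<mu> \<phi>"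
    and bdd: "bounded {x. h (g x) \<noteq> f (g x)}"
    and far: "\<And>x. h (g x) \<noteq> f (g x) \<Longrightarrow> norm u * R + 2 \<le> u \<bullet> x"
    using escape[of "norm u * R + 2"] by blast
  define E where "E = {x. h (g x) \<noteq> f (g x)} \<union> cball 0 R"
  have E: "bounded E" using bdd by (simp add: E_def)
  have hg: "h \<circ> g \<in> Conv" and fg: "f \<circ> g \<in> Conv" using h f g(1) by (auto intro: Conv_comp_linear)
  obtain C1 where C1: "\<And>x. x \<in> E \<Longrightarrow> \<bar>P x\<bar> \<le> C1" using Conv_bounded_on[OF P E] by blast
  obtain C2 where C2: "\<And>x. x \<in> E \<Longrightarrow> \<bar>Q x\<bar> \<le> C2" using Conv_bounded_on[OF Q E] by blast
  obtain C3 where C3: "\<And>x. x \<in> E \<Longrightarrow> \<bar>(h \<circ> g) x\<bar> \<le> C3" using Conv_bounded_on[OF hg E] by blast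
  obtain C4 where C4: "\<And>x. x \<in> E \<Longrightarrow> \<bar>(f \<circ> g) x\<bar> \<le> C4" using Conv_bounded_on[OF fg E] by blast
  \<comment> \<open>\<open>w\<close> has slope \<open>L\<close>; it is at most \<open>- L\<close> on the ball and at least \<open>L\<close> where the copies differ,
    and \<open>L\<close> bounds the sum of the absolute values of all four functions there.\<close>
  define L where "L = \<bar>C1\<bar> + \<bar>C2\<bar> + \<bar>C3\<bar> + \<bar>C4\<bar>"
  define w where "w = (\<lambda>x. (L *\<^sub>R u) \<bullet> x + - L * (norm u * R + 1))"
  have w: "w x = L * (u \<bullet> x - (norm u * R + 1))" for x by (simp add: w_def algebra_simps)
  have L: "0 \<le> L" by (simp add: L_def)
  have w_ge: "L \<le> w x" if "h (g x) \<noteq> f (g x)" for x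
    using mult_left_mono[OF _ L, of 1 "u \<bullet> x - (norm u * R + 1)"] far[OF that] by (simp add: w)
  have w_le: "w x \<le> - L" if "norm x \<le> R" for x
  proof -
    have "u \<bullet> x \<le> norm u * R"
      using norm_cauchy_schwarz[of u x] mult_left_mono[OF that norm_ge_zero[of u]] by linarith
    then show ?thesis
      using mult_left_mono[OF _ L, of "u \<bullet> x - (norm u * R + 1)" "-1"] by (simp add: w)
  qed
  define h' where "h' = (\<lambda>x. (h \<circ> g) x + w x)"
  define f' where "f' = (\<lambda>x. (f \<circ> g) x + w x)"
  have Conv': "h' \<in> Conv" "f' \<in> Conv"
    unfolding h'_def f'_def w_def by (rule Conv_add_affine[OF hg] Conv_add_affine[OF fg])+
  have \<mu>': "\<mu> h' = \<mu> h" "\<mu> f' = \<mu> f"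
    unfolding h'_def f'_def w_def affine_invariant[OF hg] affine_invariant[OF fg]
    by (rule g(2)[OF h] g(2)[OF f])+
  have le': "h' x \<le> f' x" for x using le[of "g x"] by (simp add: h'_def f'_def)
  have outer: "f' x \<le> P x" if "norm x \<le> R" for x
    using C1[of x] C4[of x] w_le[OF that] that by (simp add: E_def f'_def L_def)
  have inner: "Q x \<le> h' x" if "h' x \<noteq> f' x" for x
    using C2[of x] C3[of x] w_ge[of x] that by (simp add: E_def h'_def f'_def L_def)
  show thesis
  proof (rule that[of "\<lambda>x. max (P x) (h' x)" "\<lambda>x. max (Q x) (f' x)"])
    show "(\<lambda>x. max (P x) (h' x)) \<in> Conv" "(\<lambda>x. max (Q x) (f' x)) \<in> Conv"
      by (intro Conv_max P Q Conv')+
    show "max (P x) (h' x) \<le> max (Q x) (f' x)" for x using PQ(1)[of x] le'[of x] by linarith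
    show "bounded {x. max (P x) (h' x) \<noteq> max (Q x) (f' x)}"
      by (rule bounded_subset[of "{x. P x \<noteq> Q x} \<union> {x. h (g x) \<noteq> f (g x)}"])
        (auto simp: PQ(2) bdd h'_def f'_def)
    show "max (P x) (h' x) = P x \<and> max (Q x) (f' x) = Q x" if "x \<in> cball 0 r" for x
    proof -
      have "f' x \<le> P x" using outer[of x] that by (simp add: R_def)
      then show ?thesis using le'[of x] PQ(1)[of x] by linarith
    qed
    show "\<mu> (\<lambda>x. max (Q x) (f' x)) - \<mu> (\<lambda>x. max (P x) (h' x)) = (\<mu> Q - \<mu> P) + (\<mu> f - \<mu> h)"
      unfolding \<mu>'[symmetric]
    proof (rule increment_additive[OF P Q Conv' PQ(1) le' _ inner])
      show "f' x \<le> P x" if "P x \<noteq> Q x" for x using outer[of x] r0[OF that] by (simp add: R_def)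
    qed
  qed
qed

text \<open>
  Iterating the gluing step gives sequences \<open>P n \<le> Q n\<close> which become stationary on every ball and
  satisfy \<open>\<mu> (Q n) - \<mu> (P n) = n * (\<mu> f - \<mu> h)\<close>. The left-hand side converges, hence the
  increment \<open>\<mu> f - \<mu> h\<close> is zero.
\<close>
lemma eq_if_difference_escapes:
  assumes h: "h \<in> Conv" and f: "f \<in> Conv" and le: "\<And>x. h x \<le> f x"
    and escape: "\<And>K. \<exists>g. linear g \<and> (\<forall>\<phi>\<in>Conv. \<mu> (\<phi> \<circ> g) = \<mu> \<phi>) \<and>
      bounded {x. h (g x) \<noteq> f (g x)} \<and> (\<forall>x. h (g x) \<noteq> f (g x) \<longrightarrow> K \<le> u \<bullet> x)"
  shows "\<mu> f = \<mu> h"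
proof -
  define A where "A n S \<longleftrightarrow> fst S \<in> Conv \<and> snd S \<in> Conv \<and> (\<forall>x. fst S x \<le> snd S x) \<and>
      bounded {x. fst S x \<noteq> snd S x} \<and> \<mu> (snd S) - \<mu> (fst S) = real n * (\<mu> f - \<mu> h)" for n S
  define T where "T n S S' \<longleftrightarrow> (\<forall>x\<in>cball 0 (real n). fst S' x = fst S x \<and> snd S' x = snd S x)"
    for n and S S' :: "(complex ^ 'n \<Rightarrow> real) \<times> (complex ^ 'n \<Rightarrow> real)"
  have "\<exists>S. \<forall>n. A n (S n) \<and> T n (S n) (S (Suc n))"
  proof (rule dependent_nat_choice)
    show "\<exists>S. A 0 S" by (rule exI[of _ "(h, h)"]) (simp add: A_def h)
  next
    fix S n assume S: "A n S"
    obtain P' Q' where "P' \<in> Conv" "Q' \<in> Conv" "\<And>x. P' x \<le> Q' x" "bounded {x. P' x \<noteq> Q' x}"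
      "\<And>x. x \<in> cball 0 (real n) \<Longrightarrow> P' x = fst S x \<and> Q' x = snd S x"
      "\<mu> Q' - \<mu> P' = (\<mu> (snd S) - \<mu> (fst S)) + (\<mu> f - \<mu> h)"
      by (rule add_escaped_copy[OF h f le escape, of "fst S" "snd S" "real n"])
        (use S in \<open>auto simp: A_def\<close>)
    then show "\<exists>S'. A (Suc n) S' \<and> T n S S'"
      using S by (intro exI[of _ "(P', Q')"]) (simp add: A_def T_def algebra_simps)
  qed
  then obtain S where S: "\<And>n. A n (S n)" "\<And>n. T n (S n) (S (Suc n))" by blast
  obtain P where P: "P \<in> Conv" "epi_converges (\<lambda>n. fst (S n)) P"
    by (rule Conv_stationary_limit[of "\<lambda>n. fst (S n)"]) (use S in \<open>auto simp: A_def T_def\<close>)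
  obtain Q where Q: "Q \<in> Conv" "epi_converges (\<lambda>n. snd (S n)) Q"
    by (rule Conv_stationary_limit[of "\<lambda>n. snd (S n)"]) (use S in \<open>auto simp: A_def T_def\<close>)
  have "(\<lambda>n. \<mu> (snd (S n)) - \<mu> (fst (S n))) \<longlonglongrightarrow> \<mu> Q - \<mu> P"
    by (intro tendsto_diff continuous P Q) (use S(1) in \<open>auto simp: A_def\<close>)
  then have lim: "(\<lambda>n. real n * (\<mu> f - \<mu> h)) \<longlonglongrightarrow> \<mu> Q - \<mu> P"
    using S(1) by (simp add: A_def)
  have "(\<lambda>n. real (Suc n) * (\<mu> f - \<mu> h) - real n * (\<mu> f - \<mu> h)) \<longlonglongrightarrow> 0"
    using tendsto_diff[OF LIMSEQ_Suc[OF lim] lim] by simp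
  then have "(\<lambda>n. \<mu> f - \<mu> h) \<longlonglongrightarrow> 0" by (simp add: algebra_simps)
  then show ?thesis by (simp add: LIMSEQ_const_iff)
qed

end

section \<open>Hermitian transvections\<close>

definition herm :: "complex ^ 'n \<Rightarrow> complex ^ 'n \<Rightarrow> complex" where
  "herm a x = (\<Sum>i\<in>UNIV. cnj (a $ i) * x $ i)"

lemma herm_add [simp]: "herm a (x + y) = herm a x + herm a y"
  by (simp add: herm_def distrib_left sum.distrib)

lemma herm_vec_scale [simp]: "herm a (t *s x) = t * herm a x"
  by (simp add: herm_def sum_distrib_left mult.left_commute)

lemma herm_scaleR [simp]: "herm a (t *\<^sub>R x) = of_real t * herm a x"
  by (simp add: herm_def sum_distrib_left mult.left_commute scaleR_conv_of_real[where 'a=complex])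

lemma herm_diff [simp]: "herm a (x - y) = herm a x - herm a y"
  by (simp add: herm_def right_diff_distrib sum_subtractf)

lemma herm_minus [simp]: "herm a (- x) = - herm a x"
  by (simp add: herm_def sum_negf)

lemma herm_minus_left [simp]: "herm (- a) x = - herm a x"
  by (simp add: herm_def sum_negf)

lemma cnj_herm: "cnj (herm a x) = herm x a"
  by (simp add: herm_def mult.commute)

lemma Re_herm: "Re (herm a x) = a \<bullet> x"
  by (simp add: herm_def inner_vec_def inner_complex_def)

lemma herm_eq_0_commute: "herm a c = 0 \<longleftrightarrow> herm c a = 0"
  by (metis cnj_herm complex_cnj_zero)

lemma herm_axis: "herm (axis k b) x = cnj b * x $ k" "herm x (axis k b) = cnj (x $ k) * b"
  by (simp_all add: herm_def axis_def if_distrib[of cnj] if_distrib[of "\<lambda>t. t * _"] if_distrib[of "\<lambda>t. _ * t"]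
      cong: if_cong)

lemma herm_self: "herm c c = of_real ((norm c)\<^sup>2)"
proof -
  have "cnj (herm c c) = herm c c" by (rule cnj_herm)
  then show ?thesis
    using Re_herm[of c c] by (simp add: complex_eq_iff dot_square_norm)
qed

definition transvection :: "complex ^ 'n \<Rightarrow> complex ^ 'n \<Rightarrow> complex ^ 'n \<Rightarrow> complex ^ 'n" where
  "transvection a c x = x + herm a x *s c"

definition transvection_matrix :: "complex ^ 'n \<Rightarrow> complex ^ 'n \<Rightarrow> complex ^ 'n ^ 'n" where
  "transvection_matrix a c = (\<chi> i j. (if i = j then 1 else 0) + c $ i * cnj (a $ j))"

lemma transvection_matrix_mult_vec: "transvection_matrix a c *v x = transvection a c x"
proof -
  have "((if i = j then 1 else 0) + c $ i * cnj (a $ j)) * x $ j =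
      (if i = j then x $ j else 0) + c $ i * (cnj (a $ j) * x $ j)" for i j
    by (simp add: distrib_right)
  then have "(\<Sum>j\<in>UNIV. ((if i = j then 1 else 0) + c $ i * cnj (a $ j)) * x $ j) =
      x $ i + herm a x * c $ i" for i
    by (simp add: herm_def sum.distrib mult.commute flip: sum_distrib_left)
  then show ?thesis
    by (simp add: vec_eq_iff transvection_def transvection_matrix_def matrix_vector_mult_def)
qed

lemma linear_transvection: "linear (transvection a c)"
  by (rule linearI) (simp_all add: transvection_def vec_eq_iff distrib_left distrib_right mult.assoc
      scaleR_conv_of_real[where 'a=complex])

lemma transvection_inverse:
  "herm a c = 0 \<Longrightarrow> transvection a c (transvection a (- c) x) = x"
  by (simp add: transvection_def vec_eq_iff)

lemma transvection_matrix_inverse: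
  assumes "herm a c = 0"
  shows "transvection_matrix a c ** transvection_matrix a (- c) = mat 1"
proof -
  have "(transvection_matrix a c ** transvection_matrix a (- c)) *v x = mat 1 *v x" for x
    using transvection_inverse[OF assms]
    by (simp add: transvection_matrix_mult_vec flip: matrix_vector_mul_assoc)
  then show ?thesis by (simp add: matrix_eq)
qed

lemma matrix_inv_transvection_matrix:
  assumes "herm a c = 0"
  shows "matrix_inv (transvection_matrix a c) = transvection_matrix a (- c)"
proof -
  let ?A = "transvection_matrix a c" and ?B = "transvection_matrix a (- c)"
  have AB: "?A ** ?B = mat 1" "?B ** ?A = mat 1"
    using transvection_matrix_inverse[of a c] transvection_matrix_inverse[of a "- c"] assms by auto
  then have "?A ** matrix_inv ?A = mat 1 \<and> matrix_inv ?A ** ?A = mat 1"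
    unfolding matrix_inv_def by (intro someI[of "\<lambda>X. ?A ** X = mat 1 \<and> X ** ?A = mat 1"]) simp
  then have "?B ** (?A ** matrix_inv ?A) = ?B" by simp
  then show ?thesis by (simp add: matrix_mul_assoc AB)
qed

lemma conj_transpose_transvection_matrix:
  "conj_transpose (transvection_matrix a c) = transvection_matrix c a"
  by (simp add: conj_transpose_def transvection_matrix_def vec_eq_iff)

text \<open>
  A transvection \<open>T\<close> is conjugate to its square: the dilation \<open>D\<close> that doubles \<open>c\<close> and fixes the
  kernel of \<open>herm c\<close> satisfies \<open>D T = T\<^sup>2 D\<close>. So \<open>det T = (det T)\<^sup>2\<close>, and \<open>det T\<close> is not zero.
\<close>
lemma det_transvection_matrix:
  fixes a c :: "complex ^ 'n"
  assumes ac: "herm a c = 0"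
  shows "det (transvection_matrix a c) = 1"
proof (cases "c = 0")
  case True
  then have "transvection_matrix a c = mat 1"
    by (simp add: transvection_matrix_def mat_def vec_eq_iff)
  then show ?thesis by simp
next
  case False
  let ?T = "transvection_matrix a c"
  define d where "d = c /\<^sub>R (norm c)\<^sup>2"
  define D where "D = transvection_matrix d c"
  define D' where "D' = transvection_matrix d (- c /\<^sub>R 2)"
  have dc: "herm d c = 1"
    using False herm_self[of c] cnj_herm[of c d] by (simp add: d_def)
  have "D ** ?T = (?T ** ?T) ** D"
  proof -
    have "(D ** ?T) *v x = ((?T ** ?T) ** D) *v x" for x
      unfolding D_def
      by (simp add: transvection_matrix_mult_vec flip: matrix_vector_mul_assoc)
        (simp add: transvection_def dc ac vec_eq_iff algebra_simps)
    then show ?thesis by (simp add: matrix_eq)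
  qed
  then have "det D * det ?T = det ?T * det ?T * det D" by (metis det_mul)
  moreover have "det D \<noteq> 0"
  proof -
    have "(D ** D') *v x = mat 1 *v x" for x
      unfolding D_def D'_def
      by (simp add: transvection_matrix_mult_vec flip: matrix_vector_mul_assoc)
        (simp add: transvection_def dc vec_eq_iff algebra_simps scaleR_conv_of_real[where 'a=complex])
    then have "D ** D' = mat 1" by (simp add: matrix_eq)
    then have "det D * det D' = 1" by (metis det_mul det_I)
    then show ?thesis by auto
  qed
  moreover have "det ?T \<noteq> 0"
    using arg_cong[OF transvection_matrix_inverse[OF ac], of det] by (auto simp: det_mul)
  ultimately show ?thesis by (simp add: algebra_simps)
qed

text \<open>
  Inverting a transvection negates \<open>c\<close>, and the conjugate transpose swaps \<open>a\<close> and \<open>c\<close>.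
\<close>
lemma SL_contravariant_transvection:
  assumes "SL_contravariant \<Psi>" "f \<in> Conv" "herm a c = 0"
  shows "\<Psi> (f \<circ> transvection a c) z = \<Psi> f (transvection (- c) a z)"
proof -
  have "\<Psi> (f \<circ> (\<lambda>x. transvection_matrix a c *v x)) =
      \<Psi> f \<circ> (\<lambda>x. conj_transpose (matrix_inv (transvection_matrix a c)) *v x)"
    using assms det_transvection_matrix unfolding SL_contravariant_def SL_def by blast
  then show ?thesis
    by (simp add: fun_eq_iff transvection_matrix_mult_vec matrix_inv_transvection_matrix assms(3)
        conj_transpose_transvection_matrix o_def)
qed

text \<open>
  The two equations amount to 4 real ones, in a space of real dimension at least 6.
\<close>
lemma exists_common_herm_kernel:
  fixes a z :: "complex ^ 'n"
  assumes "CARD('n) \<ge> 3"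
  obtains c where "c \<noteq> 0" "herm a c = 0" "herm z c = 0"
proof -
  define L where "L = (\<lambda>x. (herm a x, herm z x))"
  have lin: "linear L" by (rule linearI) (simp_all add: L_def scaleR_conv_of_real[where 'a=complex] scaleR_Pair)
  have "\<not> inj L"
  proof
    assume "inj L"
    then have "dim (range L) = DIM(complex ^ 'n)" by (subst dim_image_eq[OF lin]) auto
    moreover have "dim (range L) \<le> DIM(complex \<times> complex)" by (rule dim_subset_UNIV)
    ultimately show False using assms by simp
  qed
  then obtain c where "L c = 0" "c \<noteq> 0" using linear_injective_0[OF lin] by blast
  then show thesis by (intro that) (auto simp: L_def zero_prod_def)
qed

section \<open>Vanishing of valuations invariant under transvections\<close>

lemma Conv_polyhedral_approximation:
  fixes f :: "complex ^ 'n \<Rightarrow> real"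
  assumes f: "f \<in> Conv" and "0 < e" and K: "compact K"
  obtains ls where "\<And>a d x. (a, d) \<in> set ls \<Longrightarrow> a \<bullet> x - d \<le> f x"
    "\<And>x. x \<in> K \<Longrightarrow> \<exists>(a, d)\<in>set ls. f x - e < a \<bullet> x - d"
proof -
  define A where "A = {l. \<forall>x. fst l \<bullet> x - snd l \<le> f x}"
  define U where "U = (\<lambda>l. {x. f x - e < fst l \<bullet> x - snd l})"
  have "open (U l)" for l
    unfolding U_def by (intro open_Collect_less continuous_intros Conv_continuous f)
  moreover have "K \<subseteq> (\<Union>l\<in>A. U l)"
  proof
    fix x0
    obtain a c where "\<And>x. a \<bullet> x + c \<le> f x" "f x0 - e < a \<bullet> x0 + c"
      using Conv_affine_minorant[OF f \<open>0 < e\<close>] by blast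
    then have "(a, - c) \<in> A" "x0 \<in> U (a, - c)" by (auto simp: A_def U_def)
    then show "x0 \<in> (\<Union>l\<in>A. U l)" by blast
  qed
  ultimately obtain B where B: "B \<subseteq> A" "finite B" "K \<subseteq> (\<Union>l\<in>B. U l)"
    by (rule compactE_image[OF K])
  obtain ls where ls: "set ls = B" using finite_list[OF B(2)] by blast
  show thesis
  proof (rule that[of ls])
    show "a \<bullet> x - d \<le> f x" if "(a, d) \<in> set ls" for a d x using that B(1) ls by (auto simp: A_def)
    show "\<exists>(a, d)\<in>set ls. f x - e < a \<bullet> x - d" if "x \<in> K" for x
      using that B(3) ls by (fastforce simp: U_def)
  qed
qed

definition max_affine :: "((complex ^ 'n) \<times> real) list \<Rightarrow> real \<Rightarrow> complex ^ 'n \<Rightarrow> real" where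
  "max_affine ls t x = foldr (\<lambda>(a, d) s. max s (a \<bullet> x - d)) ls t"

lemma max_affine_simps [simp]:
  "max_affine [] t x = t"
  "max_affine ((a, d) # ls) t x = max (max_affine ls t x) (a \<bullet> x - d)"
  by (simp_all add: max_affine_def)

lemma max_affine_ge: "t \<le> max_affine ls t x"
  by (induction ls) (auto simp: le_max_iff_disj)

lemma max_affine_ge_member: "(a, d) \<in> set ls \<Longrightarrow> a \<bullet> x - d \<le> max_affine ls t x"
  by (induction ls) (auto simp: le_max_iff_disj)

lemma max_affine_le:
  "t \<le> s \<Longrightarrow> (\<And>a d. (a, d) \<in> set ls \<Longrightarrow> a \<bullet> x - d \<le> s) \<Longrightarrow> max_affine ls t x \<le> s"
  by (induction ls) auto

lemma Conv_max_affine: "h \<in> Conv \<Longrightarrow> (\<lambda>x. max_affine ls (h x) x) \<in> Conv"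
proof (induction ls)
  case (Cons l ls)
  then show ?case
    using Conv_max[OF Cons.IH[OF Cons.prems] Conv_affine[of "fst l" "- snd l"]] by (cases l) simp
qed simp

text \<open>
  The invariance that survives when a contravariant valuation is evaluated at a fixed point: each
  \<open>a\<close> comes with one direction \<open>c\<close> along which the transvections preserve \<open>\<mu>\<close>.
\<close>
locale transvection_invariant_valuation = affinely_invariant_valuation \<mu>
  for \<mu> :: "(complex ^ 'n \<Rightarrow> real) \<Rightarrow> real" +
  assumes transvection_invariant: "\<And>a. \<exists>c. c \<noteq> 0 \<and> herm a c = 0 \<and>
      (\<forall>(s::real) \<phi>. \<phi> \<in> Conv \<longrightarrow> \<mu> (\<phi> \<circ> transvection a (s *\<^sub>R c)) = \<mu> \<phi>)"
begin

text \<open>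
  The new maximum differs from \<open>h\<close> on a bounded set where \<open>a \<bullet> x > d\<close>, because \<open>h\<close> is nonnegative.
  The transvection by \<open>s *\<^sub>R c\<close> pulls this set back in direction \<open>- c\<close> by at least
  \<open>s * d * norm c\<close>, and so \<open>eq_if_difference_escapes\<close> applies.
\<close>
lemma max_affine_eq_if_bounded:
  assumes h: "h \<in> Conv" "\<And>x. 0 \<le> h x" and d: "0 < d"
    and bdd: "bounded {x. h x < a \<bullet> x - d}"
  shows "\<mu> (\<lambda>x. max (h x) (a \<bullet> x - d)) = \<mu> h"
proof -
  obtain c where c: "c \<noteq> 0" "herm a c = 0"
    and inv: "\<And>(s::real) \<phi>. \<phi> \<in> Conv \<Longrightarrow> \<mu> (\<phi> \<circ> transvection a (s *\<^sub>R c)) = \<mu> \<phi>"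
    using transvection_invariant[of a] by blast
  obtain R where R: "0 < R" "\<And>x. h x < a \<bullet> x - d \<Longrightarrow> norm x \<le> R"
    using bdd unfolding bounded_pos by blast
  show ?thesis
  proof (rule eq_if_difference_escapes[where u = "- c"])
    show "(\<lambda>x. max (h x) (a \<bullet> x - d)) \<in> Conv"
      using Conv_max[OF h(1) Conv_affine[of a "- d"]] by simp
  next
    fix K :: real
    define s where "s = (\<bar>K\<bar> + norm c * R) / (d * (norm c)\<^sup>2)"
    have s: "s * d * (norm c)\<^sup>2 = \<bar>K\<bar> + norm c * R" using d c(1) by (simp add: s_def)
    have s0: "0 \<le> s" using d R(1) by (simp add: s_def)
    let ?g = "transvection a (s *\<^sub>R c)" and ?g' = "transvection a (- (s *\<^sub>R c))"
    have g'g: "?g' (?g x) = x" for x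
      using transvection_inverse[of a "- (s *\<^sub>R c)" x] c(2) by simp
    let ?B = "{x. h x < a \<bullet> x - d}"
    have "{x. h (?g x) < a \<bullet> ?g x - d} \<subseteq> ?g' ` ?B"
      using g'g by (force simp: image_iff)
    then have "bounded {x. h (?g x) < a \<bullet> ?g x - d}"
      using bounded_linear_image[OF bdd linear_conv_bounded_linear[THEN iffD1, OF linear_transvection]]
      by (rule bounded_subset[rotated])
    moreover have "K \<le> - c \<bullet> x" if x: "h (?g x) < a \<bullet> ?g x - d" for x
    proof -
      define y where "y = ?g x"
      have xy: "x = y - herm a y *s (s *\<^sub>R c)"
      proof -
        have "x = ?g' y" by (simp add: y_def g'g)
        also have "\<dots> = y - herm a y *s (s *\<^sub>R c)" by (simp add: transvection_def vec_eq_iff)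
        finally show ?thesis .
      qed
      have y: "norm y \<le> R" "d \<le> a \<bullet> y"
        using R(2)[of y] x h(2)[of y] by (auto simp: y_def)
      have "c \<bullet> x = c \<bullet> y - s * (a \<bullet> y) * (norm c)\<^sup>2"
        by (simp add: xy herm_self flip: Re_herm)
      moreover have "c \<bullet> y \<le> norm c * R"
        using norm_cauchy_schwarz[of c y] mult_left_mono[OF y(1) norm_ge_zero[of c]] by linarith
      moreover have "s * d * (norm c)\<^sup>2 \<le> s * (a \<bullet> y) * (norm c)\<^sup>2"
        using y(2) s0 by (intro mult_right_mono mult_left_mono) auto
      ultimately show ?thesis using s by simp
    qed
    moreover have "h y \<noteq> max (h y) (a \<bullet> y - d) \<longleftrightarrow> h y < a \<bullet> y - d" for y
      by linarith
    ultimately show "\<exists>g. linear g \<and> (\<forall>\<phi>\<in>Conv. \<mu> (\<phi> \<circ> g) = \<mu> \<phi>) \<and>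
        bounded {x. h (g x) \<noteq> max (h (g x)) (a \<bullet> g x - d)} \<and>
        (\<forall>x. h (g x) \<noteq> max (h (g x)) (a \<bullet> g x - d) \<longrightarrow> K \<le> - c \<bullet> x)"
      using inv linear_transvection by (intro exI[of _ ?g]) simp
  qed (use h in auto)
qed

lemma max_affine_list_eq_if_bounded:
  assumes h: "h \<in> Conv" "\<And>x. 0 \<le> h x"
    and "\<And>a d. (a, d) \<in> set ls \<Longrightarrow> 0 < d \<and> bounded {x. h x < a \<bullet> x - d}"
  shows "\<mu> (\<lambda>x. max_affine ls (h x) x) = \<mu> h"
  using assms(3)
proof (induction ls)
  case (Cons l ls)
  obtain a d where l: "l = (a, d)" by (cases l)
  let ?F = "\<lambda>x. max_affine ls (h x) x"
  have "{x. ?F x < a \<bullet> x - d} \<subseteq> {x. h x < a \<bullet> x - d}"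
    by (auto intro: le_less_trans[OF max_affine_ge])
  then have "bounded {x. ?F x < a \<bullet> x - d}"
    using Cons.prems[of a d] l by (auto intro: bounded_subset)
  then have "\<mu> (\<lambda>x. max (?F x) (a \<bullet> x - d)) = \<mu> ?F"
    using Cons.prems[of a d] l h order_trans[OF h(2) max_affine_ge]
    by (intro max_affine_eq_if_bounded Conv_max_affine) auto
  also have "\<mu> ?F = \<mu> h" using Cons.prems by (intro Cons.IH) auto
  finally show ?case using l by simp
qed simp

text \<open>
  Replacing \<open>0\<close> by the cone \<open>h k = max 0 (L * norm x - k)\<close>, which is steeper than all the affine
  functions, confines every modification to a bounded set. As \<open>k\<close> grows the cone recedes to
  infinity, which gives the claim by continuity.
\<close>
lemma max_affine_zero:
  assumes pos: "\<And>a d. (a, d) \<in> set ls \<Longrightarrow> 0 < d"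
  shows "\<mu> (\<lambda>x. max_affine ls 0 x) = \<mu> (\<lambda>x. 0)"
proof -
  define L where "L = (\<Sum>l\<leftarrow>ls. norm (fst l)) + 1"
  have L: "norm a + 1 \<le> L" if "(a, d) \<in> set ls" for a d
    using member_le_sum_list[of "norm a" "map (\<lambda>l. norm (fst l)) ls"] that by (force simp: L_def)
  have L0: "0 \<le> L" by (auto simp: L_def intro!: add_nonneg_nonneg sum_list_nonneg)
  define h where "h k x = max 0 (L * norm x - real k)" for k and x :: "complex ^ 'n"
  have h: "h k \<in> Conv" for k
    unfolding h_def by (intro Conv_max Conv_const Conv_scaled_norm L0)
  have step: "\<mu> (\<lambda>x. max_affine ls (h k x) x) = \<mu> (h k)" for k
  proof (rule max_affine_list_eq_if_bounded[OF h])
    fix a d assume l: "(a, d) \<in> set ls"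
    have "norm x \<le> real k" if "h k x < a \<bullet> x - d" for x
    proof -
      have "L * norm x - real k < norm a * norm x"
        using that pos[OF l] norm_cauchy_schwarz[of a x] by (simp add: h_def)
      moreover have "(norm a + 1) * norm x \<le> L * norm x"
        by (intro mult_right_mono L[OF l]) simp
      ultimately show ?thesis by (simp add: algebra_simps)
    qed
    then show "0 < d \<and> bounded {x. h k x < a \<bullet> x - d}"
      using pos[OF l] by (auto simp: bounded_iff)
  qed (simp add: h_def)
  have ev: "\<forall>\<^sub>F k in sequentially. \<forall>x\<in>cball 0 R. h k x = 0" for R
  proof (rule eventually_sequentiallyI[of "nat \<lceil>L * R\<rceil>"], rule ballI)
    fix k and x :: "complex ^ 'n" assume "nat \<lceil>L * R\<rceil> \<le> k" "x \<in> cball 0 R"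
    then have "L * norm x \<le> L * R" "L * R \<le> real k"
      using L0 by (auto intro: mult_left_mono simp: ceiling_le_iff nat_le_iff)
    then show "h k x = 0" by (simp add: h_def)
  qed
  have "(\<lambda>k. \<mu> (h k)) \<longlonglongrightarrow> \<mu> (\<lambda>x. 0)"
  proof (intro continuous h Conv_const epi_converges_if_locally_uniform)
    fix R e :: real assume "0 < e"
    then show "\<forall>\<^sub>F k in sequentially. \<forall>x\<in>cball 0 R. \<bar>h k x - 0\<bar> \<le> e"
      using ev[of R] by (auto elim: eventually_mono)
  qed
  moreover have "(\<lambda>k. \<mu> (\<lambda>x. max_affine ls (h k x) x)) \<longlonglongrightarrow> \<mu> (\<lambda>x. max_affine ls 0 x)"
  proof (intro continuous Conv_max_affine h Conv_const epi_converges_if_locally_uniform)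
    fix R e :: real assume "0 < e"
    then show "\<forall>\<^sub>F k in sequentially. \<forall>x\<in>cball 0 R. \<bar>max_affine ls (h k x) x - max_affine ls 0 x\<bar> \<le> e"
      using ev[of R] by (auto elim: eventually_mono)
  qed
  ultimately show ?thesis unfolding step by (rule LIMSEQ_unique[rotated])
qed

text \<open>
  All affine minorants of \<open>f\<close> inherit the strict negativity at the origin, so that the approximation
  from below uses only maxima to which \<open>max_affine_zero\<close> applies.
\<close>
lemma positive_part_zero:
  assumes f: "f \<in> Conv" and f0: "f 0 < 0"
  shows "\<mu> (\<lambda>x. max 0 (f x)) = \<mu> (\<lambda>x. 0)"
proof -
  define e where "e k = inverse (real (Suc k))" for k
  have "\<exists>ls. (\<forall>a d x. (a, d) \<in> set ls \<longrightarrow> a \<bullet> x - d \<le> f x) \<and>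
      (\<forall>x\<in>cball 0 (real k). \<exists>(a, d)\<in>set ls. f x - e k < a \<bullet> x - d)" for k
    using Conv_polyhedral_approximation[OF f, of "e k" "cball 0 (real k)"]
    by (metis compact_cball e_def inverse_positive_iff_positive of_nat_0_less_iff zero_less_Suc)
  then obtain ls where ls: "\<And>k a d x. (a, d) \<in> set (ls k) \<Longrightarrow> a \<bullet> x - d \<le> f x"
    "\<And>k x. x \<in> cball 0 (real k) \<Longrightarrow> \<exists>(a, d)\<in>set (ls k). f x - e k < a \<bullet> x - d"
    by metis
  have "0 < d" if "(a, d) \<in> set (ls k)" for a d k
    using ls(1)[OF that, of 0] f0 by simp
  then have zero: "\<mu> (\<lambda>x. max_affine (ls k) 0 x) = \<mu> (\<lambda>x. 0)" for k
    by (rule max_affine_zero)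
  have "(\<lambda>k. \<mu> (\<lambda>x. max_affine (ls k) 0 x)) \<longlonglongrightarrow> \<mu> (\<lambda>x. max 0 (f x))"
  proof (intro continuous Conv_max_affine Conv_max Conv_const f epi_converges_if_locally_uniform)
    fix R \<epsilon> :: real assume "0 < \<epsilon>"
    have "\<forall>\<^sub>F k in sequentially. e k < \<epsilon>"
      unfolding e_def using LIMSEQ_inverse_real_of_nat \<open>0 < \<epsilon>\<close> by (rule order_tendstoD)
    moreover have "\<forall>\<^sub>F k in sequentially. R \<le> real k"
      by (rule eventually_sequentiallyI[of "nat \<lceil>R\<rceil>"]) linarith
    ultimately show "\<forall>\<^sub>F k in sequentially. \<forall>x\<in>cball 0 R.
        \<bar>max_affine (ls k) 0 x - max 0 (f x)\<bar> \<le> \<epsilon>"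
    proof eventually_elim
      case (elim k)
      show ?case
      proof
        fix x :: "complex ^ 'n" assume "x \<in> cball 0 R"
        then have "x \<in> cball 0 (real k)" using elim by simp
        then obtain a d where l: "(a, d) \<in> set (ls k)" "f x - e k < a \<bullet> x - d" using ls(2) by blast
        have "max_affine (ls k) 0 x \<le> max 0 (f x)"
          using ls(1) by (intro max_affine_le) (auto simp: le_max_iff_disj)
        moreover have "f x - e k \<le> max_affine (ls k) 0 x"
          using max_affine_ge_member[OF l(1), of x 0] l(2) by linarith
        moreover have "0 \<le> max_affine (ls k) 0 x" by (rule max_affine_ge)
        ultimately show "\<bar>max_affine (ls k) 0 x - max 0 (f x)\<bar> \<le> \<epsilon>"
          using elim \<open>0 < \<epsilon>\<close> by linarith
      qed
    qed
  qed
  then show ?thesis unfolding zero by (simp add: LIMSEQ_const_iff)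
qed

text \<open>
  Lifting a nearly supporting affine function at the origin by \<open>e k\<close> puts it strictly above \<open>f\<close>
  there. Its maximum with \<open>f\<close> is uniformly close to \<open>f\<close>, and it is, up to an affine function, the
  positive part of a convex function that is negative at the origin.
\<close>
lemma eq_at_zero:
  assumes f: "f \<in> Conv"
  shows "\<mu> f = \<mu> (\<lambda>x. 0)"
proof -
  define e where "e k = inverse (real (Suc k))" for k
  have e: "0 < e k" for k by (simp add: e_def)
  have "\<exists>a c. (\<forall>x. a \<bullet> x + c \<le> f x) \<and> f 0 - e k < c" for k
    using Conv_affine_minorant[OF f e, of 0] by (metis inner_zero_right add_0)
  then obtain a c where ac: "\<And>k x. a k \<bullet> x + c k \<le> f x" "\<And>k. f 0 - e k < c k" by metis
  define F where "F k x = max (a k \<bullet> x + (c k + e k)) (f x)" for k x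
  have F: "F k \<in> Conv" for k unfolding F_def by (intro Conv_max Conv_affine f)
  have "\<mu> (F k) = \<mu> (\<lambda>x. 0)" for k
  proof -
    define G where "G = (\<lambda>x. f x + ((- a k) \<bullet> x + - (c k + e k)))"
    have G: "G \<in> Conv" unfolding G_def by (rule Conv_add_affine[OF f])
    have "F k = (\<lambda>x. max 0 (G x) + (a k \<bullet> x + (c k + e k)))"
      by (auto simp: F_def G_def fun_eq_iff max_def)
    then have "\<mu> (F k) = \<mu> (\<lambda>x. max 0 (G x))"
      using affine_invariant[OF Conv_max[OF Conv_const G]] by simp
    also have "\<dots> = \<mu> (\<lambda>x. 0)"
      using ac(2)[of k] by (intro positive_part_zero G) (simp add: G_def)
    finally show ?thesis .
  qed
  moreover have "(\<lambda>k. \<mu> (F k)) \<longlonglongrightarrow> \<mu> f"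
  proof (intro continuous F f epi_converges_if_locally_uniform)
    fix R \<epsilon> :: real assume "0 < \<epsilon>"
    have "\<forall>\<^sub>F k in sequentially. e k < \<epsilon>"
      unfolding e_def using LIMSEQ_inverse_real_of_nat \<open>0 < \<epsilon>\<close> by (rule order_tendstoD)
    then show "\<forall>\<^sub>F k in sequentially. \<forall>x\<in>cball 0 R. \<bar>F k x - f x\<bar> \<le> \<epsilon>"
    proof eventually_elim
      case (elim k)
      show ?case
      proof
        fix x show "\<bar>F k x - f x\<bar> \<le> \<epsilon>" using ac(1)[of k x] elim e[of k] by (simp add: F_def)
      qed
    qed
  qed
  ultimately show ?thesis by (simp add: LIMSEQ_const_iff)
qed

end

section \<open>Contravariant valuations\<close>

text \<open>
  Sets \<open>{h \<in> Conv. dist (h z) t < e}\<close> are open, since epi-convergence in \<open>Conv\<close> implies pointwise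
  convergence.
\<close>
lemma continuous_map_epi_topology_pointwise:
  fixes \<Psi> :: "(complex ^ 'n \<Rightarrow> real) \<Rightarrow> (complex ^ 'n \<Rightarrow> real)"
  assumes cont: "continuous_map epi_topology epi_topology \<Psi>"
    and F: "\<And>k. F k \<in> Conv" and f: "f \<in> Conv" and epi: "epi_converges F f"
  shows "(\<lambda>k. \<Psi> (F k) z) \<longlonglongrightarrow> \<Psi> f z"
proof (rule tendstoI)
  fix e :: real assume "0 < e"
  define U where "U = {h \<in> Conv. dist (h z) (\<Psi> f z) < e}"
  have "openin epi_topology U"
    unfolding openin_epi_topology
  proof (intro conjI allI impI)
    fix G g assume G: "range G \<subseteq> Conv \<and> g \<in> U \<and> epi_converges G g"
    then have "(\<lambda>k. G k z) \<longlonglongrightarrow> g z"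
      by (intro epi_converges_imp_pointwise) (auto simp: U_def)
    then have "(\<lambda>k. dist (G k z) (\<Psi> f z)) \<longlonglongrightarrow> dist (g z) (\<Psi> f z)"
      by (intro tendsto_intros)
    then have "\<forall>\<^sub>F k in sequentially. dist (G k z) (\<Psi> f z) < e"
      using G by (auto simp: U_def intro: order_tendstoD)
    then show "\<forall>\<^sub>F k in sequentially. G k \<in> U"
      by (rule eventually_mono) (use G in \<open>auto simp: U_def\<close>)
  qed (auto simp: U_def)
  then have "openin epi_topology {h \<in> Conv. \<Psi> h \<in> U}"
    using openin_continuous_map_preimage[OF cont] by simp
  moreover have "f \<in> {h \<in> Conv. \<Psi> h \<in> U}"
    using f \<open>0 < e\<close> continuous_map_image_subset_topspace[OF cont] by (auto simp: U_def)
  ultimately have "\<forall>\<^sub>F k in sequentially. F k \<in> {h \<in> Conv. \<Psi> h \<in> U}"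
    using F epi unfolding openin_epi_topology by blast
  then show "\<forall>\<^sub>F k in sequentially. dist (\<Psi> (F k) z) (\<Psi> f z) < e"
    by (rule eventually_mono) (simp add: U_def)
qed

text \<open>
  Transvections move a point with nonzero \<open>i\<close>-th coordinate to any point with the same \<open>i\<close>-th
  coordinate. Two such moves lead from any point with nonzero \<open>k\<close>-th coordinate to a fixed basis
  vector; the remaining points are limits of these.
\<close>
lemma Conv_transvection_invariant_constant:
  fixes p :: "complex ^ 'n \<Rightarrow> real"
  assumes n: "CARD('n) \<ge> 2" and p: "p \<in> Conv"
    and inv: "\<And>a c z. herm a c = 0 \<Longrightarrow> p (transvection a c z) = p z"
  shows "p z = p 0"
proof -
  obtain k m :: 'n where km: "k \<noteq> m"
    using n card_le_Suc0_iff_eq[of "UNIV :: 'n set"] by fastforce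
  have shift: "p (z + u) = p z" if "z $ i \<noteq> 0" "u $ i = 0" for z u and i :: 'n
  proof -
    have "herm (axis i 1) (inverse (z $ i) *s u) = 0" using that(2) by (simp add: herm_axis)
    from inv[OF this, of z] show ?thesis
      using that(1) by (simp add: transvection_def herm_axis vec_eq_iff plus_vec_def)
  qed
  have eq: "p z = p (axis m 1)" if z: "z $ k \<noteq> 0" for z
  proof -
    have "p z = p (z + (axis k (z $ k) + axis m 1 - z))"
      using km z by (intro shift[symmetric, of _ k]) (auto simp: axis_def)
    also have "\<dots> = p (axis k (z $ k) + axis m 1 + - axis k (z $ k))"
      using km by (subst shift[of _ m]) (auto simp: axis_def)
    finally show ?thesis by simp
  qed
  have "p z = p (axis m 1)" for z
  proof (cases "z $ k = 0")
    case True
    have "(\<lambda>j. z + inverse (real (Suc j)) *\<^sub>R axis k 1) \<longlonglongrightarrow> z + 0 *\<^sub>R axis k 1"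
      by (intro tendsto_intros LIMSEQ_inverse_real_of_nat)
    then have "(\<lambda>j. p (z + inverse (real (Suc j)) *\<^sub>R axis k 1)) \<longlonglongrightarrow> p z"
      using Conv_tendsto[OF p] by fastforce
    moreover have "p (z + inverse (real (Suc j)) *\<^sub>R axis k 1) = p (axis m 1)" for j
      using True by (intro eq) (simp add: axis_def del: of_nat_Suc)
    ultimately show ?thesis by (simp add: LIMSEQ_const_iff)
  qed (rule eq)
  then show ?thesis by metis
qed

theorem theorem4:
  fixes \<Psi> :: "(complex ^ 'n \<Rightarrow> real) \<Rightarrow> (complex ^ 'n \<Rightarrow> real)"
  assumes "CARD('n) \<ge> 3"
    and "\<Psi> \<in> Conv \<rightarrow> Conv"
    and "continuous_map epi_topology epi_topology \<Psi>"
    and "dually_epi_translation_invariant \<Psi>"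
    and "SL_contravariant \<Psi>"
    and "valuation_on_Conv \<Psi>"
  shows "\<exists>c::real. \<forall>f \<in> Conv. \<Psi> f = (\<lambda>x. c)"
proof -
  have reduce: "\<Psi> f z = \<Psi> (\<lambda>x. 0) z" if f: "f \<in> Conv" for f z
  proof -
    interpret transvection_invariant_valuation "\<lambda>f. \<Psi> f z"
    proof
      show "(\<lambda>k. \<Psi> (F k) z) \<longlonglongrightarrow> \<Psi> f z"
        if "\<And>k. F k \<in> Conv" "f \<in> Conv" "epi_converges F f" for F f
        using that by (rule continuous_map_epi_topology_pointwise[OF assms(3)])
      show "\<Psi> (\<lambda>x. f x + (a \<bullet> x + c)) z = \<Psi> f z" if "f \<in> Conv" for f a c
        using assms(4) that bounded_linear.linear[OF bounded_linear_inner_right[of a]]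
        unfolding dually_epi_translation_invariant_def by simp
      show "\<Psi> (\<lambda>x. max (f x) (h x)) z + \<Psi> (\<lambda>x. min (f x) (h x)) z = \<Psi> f z + \<Psi> h z"
        if "f \<in> Conv" "h \<in> Conv" "(\<lambda>x. min (f x) (h x)) \<in> Conv" for f h
        using assms(6) that unfolding valuation_on_Conv_def by blast
      \<comment> \<open>A transvection along \<open>c\<close> acts on \<open>z\<close> by one along \<open>a\<close>, which fixes \<open>z\<close> if \<open>herm c z = 0\<close>.\<close>
      fix a
      obtain c where c: "c \<noteq> 0" "herm a c = 0" "herm z c = 0"
        using exists_common_herm_kernel[OF assms(1)] by blast
      have "\<Psi> (\<phi> \<circ> transvection a (s *\<^sub>R c)) z = \<Psi> \<phi> z" if "\<phi> \<in> Conv" for s :: real and \<phi>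
      proof -
        have "herm (s *\<^sub>R c) z = 0" using c(3) herm_eq_0_commute[of z "s *\<^sub>R c"] by simp
        then have "transvection (- (s *\<^sub>R c)) a z = z" by (simp add: transvection_def)
        then show ?thesis
          using SL_contravariant_transvection[OF assms(5) that, of a "s *\<^sub>R c" z] c(2) by simp
      qed
      then show "\<exists>c. c \<noteq> 0 \<and> herm a c = 0 \<and>
          (\<forall>(s::real) \<phi>. \<phi> \<in> Conv \<longrightarrow> \<Psi> (\<phi> \<circ> transvection a (s *\<^sub>R c)) z = \<Psi> \<phi> z)"
        using c by blast
    qed
    show ?thesis by (rule eq_at_zero[OF f])
  qed
  have "\<Psi> (\<lambda>x. 0) z = \<Psi> (\<lambda>x. 0) 0" for z
  proof (rule Conv_transvection_invariant_constant)
    show "CARD('n) \<ge> 2" using assms(1) by simp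
    show "\<Psi> (\<lambda>x. 0) \<in> Conv" using assms(2) Conv_const by auto
    show "\<Psi> (\<lambda>x. 0) (transvection a c z) = \<Psi> (\<lambda>x. 0) z" if "herm a c = 0" for a c z
      using SL_contravariant_transvection[OF assms(5) Conv_const, of "c" "- a" 0 z] that
        herm_eq_0_commute[of a c] by (simp add: o_def)
  qed
  with reduce have "\<Psi> f = (\<lambda>x. \<Psi> (\<lambda>x. 0) 0)" if "f \<in> Conv" for f
    using that by auto
  then show ?thesis by blast
qed

end
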